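(* Let $T$ be a ternary $\Gamma$-semiring, let $f:M\to N$ be a morphism in $\mathsf{SMod}_{T,\Gamma}$, let $\equiv_f$ be its kernel congruence and let $\pi:M\to M/{\equiv_f}$ be the quotient map. Then there is a unique morphism $\bar f:M/{\equiv_f}\to N$ with $\bar f([m])=f(m)$ for all $m\in M$ and $f=\bar f\circ\pi$. The map $\bar f$ is injective, with image $\mathrm{Im}(f)$.
   Context: Fix a commutative monoid $(\Gamma,+,0_\Gamma)$. A ternary $\Gamma$-semiring is a commutative monoid $(T,+,0)$ with a map $T\times\Gamma\times T\times\Gamma\times T\to T$, $(a,\alpha,b,\beta,c)\mapsto a\alpha b\beta c$, that is additive in each of the five slots separately, satisfies ternary associativity $(a\alpha b\beta c)\gamma d\delta e=a\alpha(b\beta c\gamma d)\delta e=a\alpha b\beta(c\gamma d\delta e)$ for all $a,b,c,d,e\in T$, $\alpha,\beta,\gamma,\delta\in\Gamma$, and satisfies $a\alpha b\beta c=0$ whenever one of $a,b,c$ is $0$ or one of $\alpha,\beta$ is $0_\Gamma$. A ternary $\Gamma$-semimodule over $T$ is a commutative monoid $(M,+,0)$ with a map $T\times\Gamma\times M\times\Gamma\times T\to M$, $(a,\alpha,m,\beta,b)\mapsto a\alpha m\beta b$, that is additive in each of the five slots separately, satisfies $a\alpha m\beta b=0$ whenever $a=0$ or $m=0$ or $b=0$ or $\alpha=0_\Gamma$ or $\beta=0_\Gamma$, and satisfies $(a\alpha b\beta c)\gamma m\delta d=a\alpha(b\beta m\gamma c)\delta d$ for all $a,b,c,d\in T$,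 $m\in M$, $\alpha,\beta,\gamma,\delta\in\Gamma$. A morphism $f:M\to N$ is a monoid morphism with $f(a\alpha m\beta b)=a\alpha f(m)\beta b$ for all $a,b\in T$, $\alpha,\beta\in\Gamma$, $m\in M$. The resulting category is $\mathsf{SMod}_{T,\Gamma}$. A congruence on a semimodule $M$ is an equivalence relation $\equiv$ such that $x\equiv y$ implies $x+z\equiv y+z$ for all $z\in M$ and $a\alpha x\beta b\equiv a\alpha y\beta b$ for all $a,b\in T$, $\alpha,\beta\in\Gamma$. The quotient set $M/{\equiv}$ is a ternary $\Gamma$-semimodule with the operations induced from $M$; $[m]$ denotes the class of $m$. The kernel congruence of $f:M\to N$ is the congruence on $M$ given by $x\equiv_f y\iff f(x)=f(y)$. $\mathrm{Im}(f)=f(M)\subseteq N$ is the set-theoretic image. *)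

theory Defs
  imports "HOL-Algebra.Group"
begin

text \<open>
  Commutative monoids are those of HOL-Algebra, hence written multiplicatively:
  \<open>\<otimes>\<close> is the addition \<open>+\<close> and \<open>\<one>\<close> is the zero of \<open>\<Gamma>\<close>, \<open>T\<close>, \<open>M\<close>, \<open>N\<close>.
\<close>

record ('t, 'g) tern = "'t monoid" +
  tprod :: "'t \<Rightarrow> 'g \<Rightarrow> 't \<Rightarrow> 'g \<Rightarrow> 't \<Rightarrow> 't"

record ('t, 'g, 'm) smod = "'m monoid" +
  act :: "'t \<Rightarrow> 'g \<Rightarrow> 'm \<Rightarrow> 'g \<Rightarrow> 't \<Rightarrow> 'm"

locale ternary_gamma_semiring =
  Gamma: comm_monoid \<Gamma> + T: comm_monoid T
  for \<Gamma> :: "'g monoid" and T :: "('t, 'g) tern" +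
  assumes tprod_closed:
    "\<lbrakk>a \<in> carrier T; \<alpha> \<in> carrier \<Gamma>; b \<in> carrier T; \<beta> \<in> carrier \<Gamma>; c \<in> carrier T\<rbrakk>
      \<Longrightarrow> tprod T a \<alpha> b \<beta> c \<in> carrier T"
  and tprod_add1:
    "\<lbrakk>a \<in> carrier T; a' \<in> carrier T; \<alpha> \<in> carrier \<Gamma>; b \<in> carrier T; \<beta> \<in> carrier \<Gamma>; c \<in> carrier T\<rbrakk>
      \<Longrightarrow> tprod T (a \<otimes>\<^bsub>T\<^esub> a') \<alpha> b \<beta> c = tprod T a \<alpha> b \<beta> c \<otimes>\<^bsub>T\<^esub> tprod T a' \<alpha> b \<beta> c"
  and tprod_add2:
    "\<lbrakk>a \<in> carrier T; \<alpha> \<in> carrier \<Gamma>; \<alpha>' \<in> carrier \<Gamma>; b \<in> carrier T; \<beta> \<in> carrier \<Gamma>; c \<in> carrier T\<rbrakk>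
      \<Longrightarrow> tprod T a (\<alpha> \<otimes>\<^bsub>\<Gamma>\<^esub> \<alpha>') b \<beta> c = tprod T a \<alpha> b \<beta> c \<otimes>\<^bsub>T\<^esub> tprod T a \<alpha>' b \<beta> c"
  and tprod_add3:
    "\<lbrakk>a \<in> carrier T; \<alpha> \<in> carrier \<Gamma>; b \<in> carrier T; b' \<in> carrier T; \<beta> \<in> carrier \<Gamma>; c \<in> carrier T\<rbrakk>
      \<Longrightarrow> tprod T a \<alpha> (b \<otimes>\<^bsub>T\<^esub> b') \<beta> c = tprod T a \<alpha> b \<beta> c \<otimes>\<^bsub>T\<^esub> tprod T a \<alpha> b' \<beta> c"
  and tprod_add4:
    "\<lbrakk>a \<in> carrier T; \<alpha> \<in> carrier \<Gamma>; b \<in> carrier T; \<beta> \<in> carrier \<Gamma>; \<beta>' \<in> carrier \<Gamma>; c \<in> carrier T\<rbrakk>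
      \<Longrightarrow> tprod T a \<alpha> b (\<beta> \<otimes>\<^bsub>\<Gamma>\<^esub> \<beta>') c = tprod T a \<alpha> b \<beta> c \<otimes>\<^bsub>T\<^esub> tprod T a \<alpha> b \<beta>' c"
  and tprod_add5:
    "\<lbrakk>a \<in> carrier T; \<alpha> \<in> carrier \<Gamma>; b \<in> carrier T; \<beta> \<in> carrier \<Gamma>; c \<in> carrier T; c' \<in> carrier T\<rbrakk>
      \<Longrightarrow> tprod T a \<alpha> b \<beta> (c \<otimes>\<^bsub>T\<^esub> c') = tprod T a \<alpha> b \<beta> c \<otimes>\<^bsub>T\<^esub> tprod T a \<alpha> b \<beta> c'"
  and tprod_assoc_left:
    "\<lbrakk>a \<in> carrier T; b \<in> carrier T; c \<in> carrier T; d \<in> carrier T; e \<in> carrier T;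
      \<alpha> \<in> carrier \<Gamma>; \<beta> \<in> carrier \<Gamma>; \<gamma> \<in> carrier \<Gamma>; \<delta> \<in> carrier \<Gamma>\<rbrakk>
      \<Longrightarrow> tprod T (tprod T a \<alpha> b \<beta> c) \<gamma> d \<delta> e = tprod T a \<alpha> (tprod T b \<beta> c \<gamma> d) \<delta> e"
  and tprod_assoc_right:
    "\<lbrakk>a \<in> carrier T; b \<in> carrier T; c \<in> carrier T; d \<in> carrier T; e \<in> carrier T;
      \<alpha> \<in> carrier \<Gamma>; \<beta> \<in> carrier \<Gamma>; \<gamma> \<in> carrier \<Gamma>; \<delta> \<in> carrier \<Gamma>\<rbrakk>
      \<Longrightarrow> tprod T a \<alpha> (tprod T b \<beta> c \<gamma> d) \<delta> e = tprod T a \<alpha> b \<beta> (tprod T c \<gamma> d \<delta> e)"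
  and tprod_zero:
    "\<lbrakk>a \<in> carrier T; \<alpha> \<in> carrier \<Gamma>; b \<in> carrier T; \<beta> \<in> carrier \<Gamma>; c \<in> carrier T;
      a = \<one>\<^bsub>T\<^esub> \<or> b = \<one>\<^bsub>T\<^esub> \<or> c = \<one>\<^bsub>T\<^esub> \<or> \<alpha> = \<one>\<^bsub>\<Gamma>\<^esub> \<or> \<beta> = \<one>\<^bsub>\<Gamma>\<^esub>\<rbrakk>
      \<Longrightarrow> tprod T a \<alpha> b \<beta> c = \<one>\<^bsub>T\<^esub>"

locale ternary_gamma_semimodule =
  ternary_gamma_semiring \<Gamma> T + M: comm_monoid M
  for \<Gamma> :: "'g monoid" and T :: "('t, 'g) tern" and M :: "('t, 'g, 'm) smod" +
  assumes act_closed: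
    "\<lbrakk>a \<in> carrier T; \<alpha> \<in> carrier \<Gamma>; m \<in> carrier M; \<beta> \<in> carrier \<Gamma>; b \<in> carrier T\<rbrakk>
      \<Longrightarrow> act M a \<alpha> m \<beta> b \<in> carrier M"
  and act_add1:
    "\<lbrakk>a \<in> carrier T; a' \<in> carrier T; \<alpha> \<in> carrier \<Gamma>; m \<in> carrier M; \<beta> \<in> carrier \<Gamma>; b \<in> carrier T\<rbrakk>
      \<Longrightarrow> act M (a \<otimes>\<^bsub>T\<^esub> a') \<alpha> m \<beta> b = act M a \<alpha> m \<beta> b \<otimes>\<^bsub>M\<^esub> act M a' \<alpha> m \<beta> b"
  and act_add2:
    "\<lbrakk>a \<in> carrier T; \<alpha> \<in> carrier \<Gamma>; \<alpha>' \<in> carrier \<Gamma>; m \<in> carrier M; \<beta> \<in> carrier \<Gamma>; b \<in> carrier T\<rbrakk>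
      \<Longrightarrow> act M a (\<alpha> \<otimes>\<^bsub>\<Gamma>\<^esub> \<alpha>') m \<beta> b = act M a \<alpha> m \<beta> b \<otimes>\<^bsub>M\<^esub> act M a \<alpha>' m \<beta> b"
  and act_add3:
    "\<lbrakk>a \<in> carrier T; \<alpha> \<in> carrier \<Gamma>; m \<in> carrier M; m' \<in> carrier M; \<beta> \<in> carrier \<Gamma>; b \<in> carrier T\<rbrakk>
      \<Longrightarrow> act M a \<alpha> (m \<otimes>\<^bsub>M\<^esub> m') \<beta> b = act M a \<alpha> m \<beta> b \<otimes>\<^bsub>M\<^esub> act M a \<alpha> m' \<beta> b"
  and act_add4:
    "\<lbrakk>a \<in> carrier T; \<alpha> \<in> carrier \<Gamma>; m \<in> carrier M; \<beta> \<in> carrier \<Gamma>; \<beta>' \<in> carrier \<Gamma>; b \<in> carrier T\<rbrakk>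
      \<Longrightarrow> act M a \<alpha> m (\<beta> \<otimes>\<^bsub>\<Gamma>\<^esub> \<beta>') b = act M a \<alpha> m \<beta> b \<otimes>\<^bsub>M\<^esub> act M a \<alpha> m \<beta>' b"
  and act_add5:
    "\<lbrakk>a \<in> carrier T; \<alpha> \<in> carrier \<Gamma>; m \<in> carrier M; \<beta> \<in> carrier \<Gamma>; b \<in> carrier T; b' \<in> carrier T\<rbrakk>
      \<Longrightarrow> act M a \<alpha> m \<beta> (b \<otimes>\<^bsub>T\<^esub> b') = act M a \<alpha> m \<beta> b \<otimes>\<^bsub>M\<^esub> act M a \<alpha> m \<beta> b'"
  and act_zero:
    "\<lbrakk>a \<in> carrier T; \<alpha> \<in> carrier \<Gamma>; m \<in> carrier M; \<beta> \<in> carrier \<Gamma>; b \<in> carrier T;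
      a = \<one>\<^bsub>T\<^esub> \<or> m = \<one>\<^bsub>M\<^esub> \<or> b = \<one>\<^bsub>T\<^esub> \<or> \<alpha> = \<one>\<^bsub>\<Gamma>\<^esub> \<or> \<beta> = \<one>\<^bsub>\<Gamma>\<^esub>\<rbrakk>
      \<Longrightarrow> act M a \<alpha> m \<beta> b = \<one>\<^bsub>M\<^esub>"
  and act_assoc:
    "\<lbrakk>a \<in> carrier T; b \<in> carrier T; c \<in> carrier T; d \<in> carrier T; m \<in> carrier M;
      \<alpha> \<in> carrier \<Gamma>; \<beta> \<in> carrier \<Gamma>; \<gamma> \<in> carrier \<Gamma>; \<delta> \<in> carrier \<Gamma>\<rbrakk>
      \<Longrightarrow> act M (tprod T a \<alpha> b \<beta> c) \<gamma> m \<delta> d = act M a \<alpha> (act M b \<beta> m \<gamma> c) \<delta> d"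

text \<open>
  A morphism is taken extensional (\<open>undefined\<close> outside the carrier of its source), so that
  equality in HOL is equality of morphisms and \<open>\<exists>!\<close> expresses their uniqueness.
  Being a morphism includes that source and target are semimodules.
\<close>

locale semimodule_morphism =
  M: ternary_gamma_semimodule \<Gamma> T M + N: ternary_gamma_semimodule \<Gamma> T N
  for \<Gamma> :: "'g monoid" and T :: "('t, 'g) tern"
    and M :: "('t, 'g, 'm) smod" and N :: "('t, 'g, 'n) smod" and f :: "'m \<Rightarrow> 'n" +
  assumes extensional: "f \<in> extensional (carrier M)"
  and hom: "f \<in> hom M N"
  and zero: "f \<one>\<^bsub>M\<^esub> = \<one>\<^bsub>N\<^esub>"
  and act: "\<lbrakk>a \<in> carrier T; \<alpha> \<in> carrier \<Gamma>; m \<in> carrier M; \<beta> \<in> carrier \<Gamma>; b \<in> carrier T\<rbrakk>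
      \<Longrightarrow> f (act M a \<alpha> m \<beta> b) = act N a \<alpha> (f m) \<beta> b"

locale semimodule_congruence =
  ternary_gamma_semimodule \<Gamma> T M
  for \<Gamma> :: "'g monoid" and T :: "('t, 'g) tern" and M :: "('t, 'g, 'm) smod"
    and R :: "('m \<times> 'm) set" +
  assumes equiv: "equiv (carrier M) R"
  and add: "\<lbrakk>(x, y) \<in> R; z \<in> carrier M\<rbrakk> \<Longrightarrow> (x \<otimes>\<^bsub>M\<^esub> z, y \<otimes>\<^bsub>M\<^esub> z) \<in> R"
  and act: "\<lbrakk>(x, y) \<in> R; a \<in> carrier T; \<alpha> \<in> carrier \<Gamma>; \<beta> \<in> carrier \<Gamma>; b \<in> carrier T\<rbrakk>
      \<Longrightarrow> (act M a \<alpha> x \<beta> b, act M a \<alpha> y \<beta> b) \<in> R"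

text \<open>
  The operations on classes follow the pattern of \<^theory>\<open>HOL.Equiv_Relations\<close>: for a congruence,
  all sets in each union coincide (see \<open>quot_add\<close> and \<open>quot_act\<close> below).
\<close>

definition quot_smod :: "('t, 'g, 'm) smod \<Rightarrow> ('m \<times> 'm) set \<Rightarrow> ('t, 'g, 'm set) smod" where
  "quot_smod M R =
    \<lparr>carrier = carrier M // R,
     mult = (\<lambda>X Y. \<Union>x\<in>X. \<Union>y\<in>Y. R `` {x \<otimes>\<^bsub>M\<^esub> y}),
     one = R `` {\<one>\<^bsub>M\<^esub>},
     act = (\<lambda>a \<alpha> X \<beta> b. \<Union>x\<in>X. R `` {act M a \<alpha> x \<beta> b})\<rparr>"

definition quot_map :: "('t, 'g, 'm) smod \<Rightarrow> ('m \<times> 'm) set \<Rightarrow> 'm \<Rightarrow> 'm set" where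
  "quot_map M R = (\<lambda>m\<in>carrier M. R `` {m})"

definition kernel_congruence :: "('t, 'g, 'm) smod \<Rightarrow> ('m \<Rightarrow> 'n) \<Rightarrow> ('m \<times> 'm) set" where
  "kernel_congruence M f = {(x, y). x \<in> carrier M \<and> y \<in> carrier M \<and> f x = f y}"

context semimodule_congruence
begin

lemma in_carrier: "(x, y) \<in> R \<Longrightarrow> x \<in> carrier M \<and> y \<in> carrier M"
  using equiv by (auto simp: equiv_def)

lemma add2:
  assumes "(x, x') \<in> R" "(y, y') \<in> R"
  shows "(x \<otimes>\<^bsub>M\<^esub> y, x' \<otimes>\<^bsub>M\<^esub> y') \<in> R"
proof -
  have "(x \<otimes>\<^bsub>M\<^esub> y, x' \<otimes>\<^bsub>M\<^esub> y) \<in> R" "(y \<otimes>\<^bsub>M\<^esub> x', y' \<otimes>\<^bsub>M\<^esub> x') \<in> R"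
    using assms in_carrier add by blast+
  then show ?thesis
    using assms in_carrier M.m_comm equiv by (metis equivE transE)
qed

lemma quot_add:
  assumes "x \<in> carrier M" "y \<in> carrier M"
  shows "R `` {x} \<otimes>\<^bsub>quot_smod M R\<^esub> R `` {y} = R `` {x \<otimes>\<^bsub>M\<^esub> y}"
proof -
  have "congruent2 R R (\<lambda>x y. R `` {x \<otimes>\<^bsub>M\<^esub> y})"
    unfolding congruent2_def using add2 equiv_class_eq[OF equiv] by blast
  from UN_equiv_class2[OF equiv equiv this assms] show ?thesis
    by (simp add: quot_smod_def)
qed

lemma quot_act:
  assumes "a \<in> carrier T" "\<alpha> \<in> carrier \<Gamma>" "x \<in> carrier M" "\<beta> \<in> carrier \<Gamma>" "b \<in> carrier T"
  shows "act (quot_smod M R) a \<alpha> (R `` {x}) \<beta> b = R `` {act M a \<alpha> x \<beta> b}"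
proof -
  have "congruent R (\<lambda>x. R `` {act M a \<alpha> x \<beta> b})"
    unfolding congruent_def using act equiv_class_eq[OF equiv] assms by blast
  from UN_equiv_class[OF equiv this assms(3)] show ?thesis
    by (simp add: quot_smod_def)
qed

lemma quot_carrierE:
  assumes "X \<in> carrier (quot_smod M R)"
  obtains x where "x \<in> carrier M" "X = R `` {x}"
  using assms by (auto simp: quot_smod_def elim: quotientE)

lemma quot_carrierI: "x \<in> carrier M \<Longrightarrow> R `` {x} \<in> carrier (quot_smod M R)"
  by (simp add: quot_smod_def quotientI)

lemma quot_zero: "\<one>\<^bsub>quot_smod M R\<^esub> = R `` {\<one>\<^bsub>M\<^esub>}"
  by (simp add: quot_smod_def)

theorem quot_semimodule: "ternary_gamma_semimodule \<Gamma> T (quot_smod M R)"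
proof -
  interpret Q: comm_monoid "quot_smod M R"
    by (rule comm_monoidI)
      (auto elim!: quot_carrierE simp: quot_add quot_zero quot_carrierI M.m_ac)
  show ?thesis
  proof (intro ternary_gamma_semimodule.intro ternary_gamma_semimodule_axioms.intro)
    show "ternary_gamma_semiring \<Gamma> T" "comm_monoid (quot_smod M R)"
      by unfold_locales
  next
    fix a \<alpha> X \<beta> b
    assume *: "a \<in> carrier T" "\<alpha> \<in> carrier \<Gamma>" "X \<in> carrier (quot_smod M R)" "\<beta> \<in> carrier \<Gamma>"
      "b \<in> carrier T"
      and z: "a = \<one>\<^bsub>T\<^esub> \<or> X = \<one>\<^bsub>quot_smod M R\<^esub> \<or> b = \<one>\<^bsub>T\<^esub> \<or> \<alpha> = \<one>\<^bsub>\<Gamma>\<^esub> \<or> \<beta> = \<one>\<^bsub>\<Gamma>\<^esub>"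
    obtain x where x: "x \<in> carrier M" "X = R `` {x}" "X = \<one>\<^bsub>quot_smod M R\<^esub> \<Longrightarrow> x = \<one>\<^bsub>M\<^esub>"
      using *(3) quot_zero M.one_closed by (metis quot_carrierE)
    then have "act M a \<alpha> x \<beta> b = \<one>\<^bsub>M\<^esub>"
      using * z by (intro act_zero) auto
    then show "act (quot_smod M R) a \<alpha> X \<beta> b = \<one>\<^bsub>quot_smod M R\<^esub>"
      using * x(1,2) by (simp add: quot_act quot_zero)
  qed (erule quot_carrierE; (erule quot_carrierE)?;
      simp add: quot_add quot_act quot_carrierI act_closed tprod_closed
        act_add1 act_add2 act_add3 act_add4 act_add5 act_assoc)+
qed

end

context semimodule_morphism
begin

theorem kernel_congruence: "semimodule_congruence \<Gamma> T M (kernel_congruence M f)"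
proof
  show "equiv (carrier M) (kernel_congruence M f)"
    by (rule equivI) (auto simp: kernel_congruence_def refl_on_def sym_def trans_def)
qed (use hom in \<open>auto simp: kernel_congruence_def hom_def M.act_closed act\<close>)

end

end

theory Submission
  imports Defs
begin

text \<open>The classes of \<open>K\<close> are exactly the nonempty fibres of \<open>f\<close>. So
  \<open>f\<close> takes a single value on each class, which defines the induced map, and different
  values on different classes, which makes it injective. The quotient operations act on
  representatives (\<open>K.quot_add\<close>, \<open>K.quot_act\<close>), so the morphism laws
  descend from \<open>f\<close>.\<close>

theorem proposition5p3:
  fixes \<Gamma> :: "'g monoid" and T :: "('t, 'g) tern"
    and M :: "('t, 'g, 'm) smod" and N :: "('t, 'g, 'n) smod" and f :: "'m \<Rightarrow> 'n"
  assumes "ternary_gamma_semiring \<Gamma> T"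
    and "semimodule_morphism \<Gamma> T M N f"
  defines "K \<equiv> kernel_congruence M f"
  defines "is_induced \<equiv> \<lambda>g. semimodule_morphism \<Gamma> T (quot_smod M K) N g
      \<and> (\<forall>m\<in>carrier M. g (K `` {m}) = f m)
      \<and> f = compose (carrier M) g (quot_map M K)"
  shows "(\<exists>!g. is_induced g) \<and>
    (\<forall>g. is_induced g \<longrightarrow>
      inj_on g (carrier (quot_smod M K)) \<and> g ` carrier (quot_smod M K) = f ` carrier M)"
proof -
  interpret f: semimodule_morphism \<Gamma> T M N f by (fact assms(2))
  interpret K: semimodule_congruence \<Gamma> T M K
    unfolding K_def by (rule f.kernel_congruence)
  let ?Q = "quot_smod M K"
  have K_eq: "K `` {x} = K `` {y} \<longleftrightarrow> f x = f y"
    if "x \<in> carrier M" "y \<in> carrier M" for x y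
    using that eq_equiv_class_iff[OF K.equiv that]
    by (simp add: K_def kernel_congruence_def)
  \<comment> \<open>Only the values of \<open>g\<close> on classes matter here, so the argument
    covers every induced map, not just the one constructed below.\<close>
  have inj: "inj_on g (carrier ?Q)" and image: "g ` carrier ?Q = f ` carrier M"
    if "is_induced g" for g
  proof -
    have g: "g (K `` {m}) = f m" if "m \<in> carrier M" for m
      using \<open>is_induced g\<close> that by (simp add: is_induced_def)
    show "inj_on g (carrier ?Q)"
      by (rule inj_onI) (metis K.quot_carrierE K_eq g)
    show "g ` carrier ?Q = f ` carrier M"
      using K.quot_carrierI g by (force elim: K.quot_carrierE)
  qed
  \<comment> \<open>On classes both values are prescribed by \<open>f\<close>; elsewhere
    extensionality makes both \<open>undefined\<close>.\<close>
  have unique: "g = h" if "is_induced g" "is_induced h" for g h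
  proof (rule extensionalityI)
    show "g \<in> extensional (carrier ?Q)" "h \<in> extensional (carrier ?Q)"
      using that by (auto simp: is_induced_def semimodule_morphism.extensional)
    show "g X = h X" if "X \<in> carrier ?Q" for X
      using that \<open>is_induced g\<close> \<open>is_induced h\<close>
      by (auto simp: is_induced_def elim!: K.quot_carrierE)
  qed
  \<comment> \<open>The image of a class under \<open>f\<close> is a singleton, so its element can
    be taken without choosing a representative.\<close>
  define g where "g = (\<lambda>X\<in>carrier ?Q. the_elem (f ` X))"
  have g: "g (K `` {m}) = f m" if "m \<in> carrier M" for m
  proof -
    have "f ` (K `` {m}) = {f m}"
      using that by (auto simp: K_def kernel_congruence_def)
    with that show ?thesis
      by (simp add: g_def K.quot_carrierI)
  qed
  have "semimodule_morphism \<Gamma> T ?Q N g"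
  proof (intro semimodule_morphism.intro semimodule_morphism_axioms.intro)
    show "ternary_gamma_semimodule \<Gamma> T ?Q" by (rule K.quot_semimodule)
    show "ternary_gamma_semimodule \<Gamma> T N" by unfold_locales
    show "g \<in> extensional (carrier ?Q)" by (simp add: g_def)
    \<comment> \<open>Once elements of the quotient are written as classes, this is additivity of
      \<open>f\<close> on representatives.\<close>
    show "g \<in> hom ?Q N"
      using f.hom by (auto simp: hom_def g K.quot_add elim!: K.quot_carrierE)
    show "g \<one>\<^bsub>?Q\<^esub> = \<one>\<^bsub>N\<^esub>"
      by (simp add: K.quot_zero g f.zero)
    show "g (act ?Q a \<alpha> X \<beta> b) = act N a \<alpha> (g X) \<beta> b"
      if "a \<in> carrier T" "\<alpha> \<in> carrier \<Gamma>" "X \<in> carrier ?Q" "\<beta> \<in> carrier \<Gamma>" "b \<in> carrier T"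
      for a \<alpha> X \<beta> b
      using that(3) that(1,2,4,5)
      by (elim K.quot_carrierE) (simp add: K.quot_act g f.M.act_closed f.act)
  qed
  \<comment> \<open>Both sides are \<open>undefined\<close> off \<open>carrier M\<close>, so
    equality need only be checked on it.\<close>
  moreover have "f = compose (carrier M) g (quot_map M K)"
    by (rule extensionalityI[OF f.extensional compose_extensional])
      (simp add: compose_eq quot_map_def g)
  ultimately have "is_induced g"
    by (simp add: is_induced_def g)
  with unique inj image show ?thesis by blast
qed

end
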